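(* Let $k, m \in \mathbb{N}_0$ with $m \geq k$, and let $x\in\mathbb{C}$ with $\operatorname{Re} x>0$. Then $$P_k(m, x) = \sum_{j=0}^{k} (-1)^{j-k} x^{j} \binom{j+m-k}{m-k}\left[{m+1 \atop j+m-k+1}\right]$$ and $$P_k(m,x)= \sum_{j=m-k}^{m} (-1)^{j-m} x^{j+k-m} \binom{j}{m-k} \frac{m!}{j!}\, B_{j}\left(H_m^{(1)},-H_m^{(2)},\ldots, (-1)^{j-1} (j-1)!\, H_m^{(j)}\right).$$
   Context: $\mathbb{N}_0=\{0,1,2,\ldots\}$. $(a)_n := a(a+1)\cdots(a+n-1)$ is the rising factorial, with $(a)_0=1$. Signed generalized Stirling polynomials of the first kind: for $m\in\mathbb{N}_0$ and $x\in\mathbb{C}$, the numbers $P_k(m,x)$, $0\le k\le m$, are defined by the polynomial identity in $j$ $$(j+1)_m = \sum_{k=0}^m (-1)^k P_k(m, x)\,(j + x)^{m-k}.$$ $\left[{n \atop k}\right]$ denotes the Stirling cycle number (unsigned Stirling number of the first kind), i.e. $(x-n+1)_n=\sum_{k=0}^n(-1)^{n-k}\left[{n\atop k}\right]x^k$. Complete Bell polynomials: $\exp\left(\sum_{r\ge1} x_r \frac{t^r}{r!}\right) = \sum_{n\ge0} B_{n}(x_1,\ldots,x_n) \frac{t^n}{n!}$ (so $B_0=1$). In the claim the $r$-th argument of $B_j$ is $(-1)^{r-1}(r-1)!\,H_m^{(r)}$ for $1\le r\le j$. Generalized harmonic numbers: $H_m^{(r)}=\sum_{i=1}^m i^{-r}$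 (equal to $0$ if $m=0$). *)

theory Defs
  imports Complex_Main
    "HOL-Computational_Algebra.Computational_Algebra"
    "HOL-Combinatorics.Stirling"
begin

definition gen_stirling_coeffs :: "nat \<Rightarrow> complex \<Rightarrow> (nat \<Rightarrow> complex) \<Rightarrow> bool" where
  "gen_stirling_coeffs m x P \<longleftrightarrow>
     (\<forall>j::complex. pochhammer (j + 1) m = (\<Sum>k\<le>m. (-1) ^ k * P k * (j + x) ^ (m - k)))"

text \<open>The defining identity constrains only the indices up to \<open>m\<close>; the extra condition fixes
  the remaining values so that the description is unique (see the lemma below).\<close>

definition gen_stirling_poly :: "nat \<Rightarrow> nat \<Rightarrow> complex \<Rightarrow> complex" where
  "gen_stirling_poly k m x = (THE P. gen_stirling_coeffs m x P \<and> (\<forall>i>m. P i = 0)) k"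

lemma gen_stirling_coeffs_exists: "\<exists>P. gen_stirling_coeffs m x P"
proof -
  define p :: "complex poly" where "p = (\<Prod>i<m. [:1 - x + of_nat i, 1:])"
  have pp: "poly p (j + x) = pochhammer (j + 1) m" for j
    unfolding p_def pochhammer_prod poly_prod atLeast0LessThan
    by (intro prod.cong refl) (simp add: algebra_simps)
  have "degree p \<le> sum (degree \<circ> (\<lambda>i. [:1 - x + of_nat i, 1:])) {..<m}"
    unfolding p_def by (rule degree_prod_sum_le) simp
  hence d: "degree p \<le> m" by simp
  have "gen_stirling_coeffs m x (\<lambda>k. (-1) ^ k * coeff p (m - k))"
    unfolding gen_stirling_coeffs_def
  proof
    fix j :: complex
    have "pochhammer (j + 1) m = (\<Sum>i\<le>m. coeff p i * (j + x) ^ i)"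
      using arg_cong[OF poly_as_sum_of_monoms'[OF d], of "\<lambda>q. poly q (j + x)"]
      by (simp add: pp poly_sum poly_monom)
    also have "\<dots> = (\<Sum>k\<le>m. coeff p (m - k) * (j + x) ^ (m - k))"
      by (rule sum.reindex_bij_witness[of _ "\<lambda>i. m - i" "\<lambda>i. m - i"]) auto
    also have "\<dots> = (\<Sum>k\<le>m. (-1) ^ k * ((-1) ^ k * coeff p (m - k)) * (j + x) ^ (m - k))"
      by (intro sum.cong refl) (simp add: mult.assoc[symmetric])
    finally show "pochhammer (j + 1) m = \<dots>" .
  qed
  thus ?thesis by blast
qed

lemma gen_stirling_coeffs_unique:
  assumes "gen_stirling_coeffs m x P" "gen_stirling_coeffs m x Q" "k \<le> m"
  shows "P k = Q k"
proof -
  define c where "c i = (-1) ^ (m - i) * (P (m - i) - Q (m - i))" for i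
  have "(\<Sum>i\<le>m. c i * z ^ i) = 0" for z
  proof -
    have "(\<Sum>i\<le>m. c i * z ^ i) = (\<Sum>k\<le>m. c (m - k) * z ^ (m - k))"
      by (rule sum.reindex_bij_witness[of _ "\<lambda>i. m - i" "\<lambda>i. m - i"]) auto
    also have "\<dots> = (\<Sum>k\<le>m. (-1) ^ k * P k * (z - x + x) ^ (m - k))
                   - (\<Sum>k\<le>m. (-1) ^ k * Q k * (z - x + x) ^ (m - k))"
      unfolding sum_subtractf[symmetric]
      by (intro sum.cong refl) (simp add: c_def algebra_simps)
    also have "\<dots> = 0"
      using assms(1)[unfolded gen_stirling_coeffs_def, rule_format, of "z - x"]
        assms(2)[unfolded gen_stirling_coeffs_def, rule_format, of "z - x"] by (metis diff_self)
    finally show ?thesis .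
  qed
  hence "\<forall>i\<le>m. c i = 0" using polyfun_eq_0[where c = c and n = m] by blast
  hence "c (m - k) = 0" by simp
  thus ?thesis using assms(3) by (simp add: c_def)
qed

lemma gen_stirling_poly_unique:
  "\<exists>!P. gen_stirling_coeffs m x P \<and> (\<forall>i>m. P i = 0)"
proof -
  obtain P where P: "gen_stirling_coeffs m x P" using gen_stirling_coeffs_exists by blast
  have "gen_stirling_coeffs m x (\<lambda>k. if k \<le> m then P k else 0)"
    using P unfolding gen_stirling_coeffs_def by simp
  moreover have "Q = R"
    if "gen_stirling_coeffs m x Q \<and> (\<forall>i>m. Q i = 0)"
       "gen_stirling_coeffs m x R \<and> (\<forall>i>m. R i = 0)" for Q R
  proof
    fix i show "Q i = R i"
      using that gen_stirling_coeffs_unique[of m x Q R i] by (cases "i \<le> m") auto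
  qed
  ultimately show ?thesis
    by (intro ex_ex1I[OF exI[of _ "\<lambda>k. if k \<le> m then P k else 0"]]) simp_all
qed

lemma gen_stirling_poly_identity:
  "pochhammer (j + 1) m = (\<Sum>k\<le>m. (-1) ^ k * gen_stirling_poly k m x * (j + x) ^ (m - k))"
  using theI'[OF gen_stirling_poly_unique[of m x]]
  unfolding gen_stirling_poly_def gen_stirling_coeffs_def by blast

text \<open>The coefficients of the exponential generating function of the complete Bell polynomials;
  the arguments are \<open>v 1, \<dots>, v n\<close>, and \<open>v 0\<close> is ignored.\<close>

definition complete_bell :: "nat \<Rightarrow> (nat \<Rightarrow> complex) \<Rightarrow> complex" where
  "complete_bell n v =
     fact n * fps_nth (fps_exp 1 oo Abs_fps (\<lambda>r. if r = 0 then 0 else v r / fact r)) n"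

definition gen_harm :: "nat \<Rightarrow> nat \<Rightarrow> complex" where
  "gen_harm r m = (\<Sum>i=1..m. 1 / of_nat i ^ r)"

end

theory Submission
  imports Defs
begin

text \<open>
  In powers of \<open>z\<close>, the rising factorial \<open>(z + 1)\<^sub>m\<close> has the coefficients
  \<open>stirling (m + 1) (n + 1)\<close>: divide the classical expansion of \<open>(z)\<^sub>m\<^sub>+\<^sub>1\<close> by \<open>z\<close>.
  The numbers \<open>P\<^sub>k(m, x)\<close> are, up to sign, the coefficients of the same polynomial in powers of
  \<open>y = z + x\<close>. Re-expanding \<open>z\<^sup>n = (y - x)\<^sup>n\<close> by the binomial theorem and comparing coefficients
  of \<open>y\<^sup>m\<^sup>-\<^sup>k\<close> therefore expresses \<open>P\<^sub>k(m, x)\<close> through cycle numbers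
  (\<open>gen_stirling_poly_taylor\<close>), which is the first formula after an index shift.

  The second formula has the same sum with each cycle number written as
  \<open>stirling (m + 1) (j + 1) = m!/j! B\<^sub>j(H\<^sub>m\<^sup>(\<^sup>1\<^sup>), - H\<^sub>m\<^sup>(\<^sup>2\<^sup>), \<dots>)\<close>
  (\<open>stirling_eq_complete_bell\<close>). Analytically this is
  \<open>(t + 1)\<^sub>m = m! (1 + t/1) \<cdots> (1 + t/m) = m! exp (\<Sum>i. log (1 + t/i))\<close>, where expanding the
  logarithms produces the harmonic numbers as power sums of \<open>1, 1/2, \<dots>, 1/m\<close>. For formal power
  series it is convenient to avoid logarithms: both sides have the same constant term and the same
  logarithmic derivative \<open>\<Sum>i. 1/(i + t)\<close>, and a linear differential equation of first order
  has only one solution with given constant term (\<open>fps_linear_ODE_unique\<close>).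
\<close>

section \<open>Cycle numbers and the Taylor shift\<close>

lemma pochhammer_plus_one_stirling:
  "pochhammer (z + 1) m = (\<Sum>n\<le>m. of_nat (stirling (Suc m) (Suc n)) * (z::complex) ^ n)"
proof (cases "z = 0")
  case True
  have "(\<Sum>n\<le>m. of_nat (stirling (Suc m) (Suc n)) * (0::complex) ^ n)
      = of_nat (stirling (Suc m) (Suc 0))"
    by (simp add: sum.atMost_shift)
  also have "\<dots> = fact m"
    using stirling_Suc_n_1[of m] by simp
  finally show ?thesis using True by (simp add: pochhammer_fact)
next
  case False
  have "z * pochhammer (z + 1) m = pochhammer z (Suc m)"
    by (simp add: pochhammer_rec)
  also have "\<dots> = (\<Sum>k\<le>Suc m. of_nat (stirling (Suc m) k) * z ^ k)"
    by (rule stirling_pochhammer[symmetric])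
  also have "\<dots> = z * (\<Sum>n\<le>m. of_nat (stirling (Suc m) (Suc n)) * z ^ n)"
    by (subst sum.atMost_Suc_shift) (simp add: sum_distrib_left mult_ac del: stirling.simps(4))
  finally show ?thesis using False by simp
qed

lemma polynomial_taylor_shift:
  fixes a y :: "'a::comm_ring_1"
  shows "(\<Sum>n\<le>m. c n * (y + a) ^ n)
       = (\<Sum>l\<le>m. (\<Sum>n=l..m. c n * of_nat (n choose l) * a ^ (n - l)) * y ^ l)"
proof -
  have "(\<Sum>n\<le>m. c n * (y + a) ^ n)
      = (\<Sum>n\<le>m. \<Sum>l\<le>n. c n * of_nat (n choose l) * a ^ (n - l) * y ^ l)"
    by (simp add: binomial_ring sum_distrib_left mult_ac)
  also have "\<dots> = (\<Sum>l\<le>m. \<Sum>n=l..m. c n * of_nat (n choose l) * a ^ (n - l) * y ^ l)"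
    unfolding sum.Sigma[OF finite_atMost ballI[OF finite_atMost]]
      sum.Sigma[OF finite_atMost ballI[OF finite_atLeastAtMost]]
    by (rule sum.reindex_bij_witness[of _ prod.swap prod.swap]) auto
  finally show ?thesis by (simp add: sum_distrib_right)
qed

lemma gen_stirling_poly_eqI:
  assumes "gen_stirling_coeffs m x P" "k \<le> m"
  shows "gen_stirling_poly k m x = P k"
proof -
  have "gen_stirling_coeffs m x (\<lambda>k. gen_stirling_poly k m x)"
    unfolding gen_stirling_coeffs_def using gen_stirling_poly_identity by blast
  from gen_stirling_coeffs_unique[OF this assms] show ?thesis .
qed

text \<open>Summing over the exponent of \<open>z\<close> keeps the cycle number in the form
  \<open>stirling (Suc m) (Suc n)\<close>, so that both formulas of the theorem are read off from here.\<close>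

lemma gen_stirling_poly_taylor:
  assumes "k \<le> m"
  shows "gen_stirling_poly k m x
       = (\<Sum>n=m-k..m. (-1) ^ k * of_nat (stirling (Suc m) (Suc n)) * of_nat (n choose (m - k))
            * (- x) ^ (n - (m - k)))"
proof -
  define c :: "nat \<Rightarrow> complex" where "c n = of_nat (stirling (Suc m) (Suc n))" for n
  define T where "T l = (\<Sum>n=l..m. c n * of_nat (n choose l) * (- x) ^ (n - l))" for l
  have "gen_stirling_coeffs m x (\<lambda>k. (-1) ^ k * T (m - k))"
    unfolding gen_stirling_coeffs_def
  proof
    fix j :: complex
    have "pochhammer (j + 1) m = (\<Sum>n\<le>m. c n * ((j + x) + - x) ^ n)"
      unfolding c_def by (simp add: pochhammer_plus_one_stirling del: stirling.simps)
    also have "\<dots> = (\<Sum>l\<le>m. T l * (j + x) ^ l)"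
      unfolding T_def by (rule polynomial_taylor_shift)
    also have "\<dots> = (\<Sum>k\<le>m. T (m - k) * (j + x) ^ (m - k))"
      by (rule sum.reindex_bij_witness[of _ "\<lambda>i. m - i" "\<lambda>i. m - i"]) auto
    also have "\<dots> = (\<Sum>k\<le>m. (-1) ^ k * ((-1) ^ k * T (m - k)) * (j + x) ^ (m - k))"
      by (intro sum.cong refl) (simp add: mult.assoc[symmetric])
    finally show "pochhammer (j + 1) m = \<dots>" .
  qed
  from gen_stirling_poly_eqI[OF this assms] show ?thesis
    by (simp add: T_def c_def sum_distrib_left mult.assoc del: stirling.simps)
qed

section \<open>Cycle numbers as Bell polynomials of harmonic numbers\<close>

lemma fps_linear_ODE_unique:
  fixes a b g :: "'a::field_char_0 fps"
  assumes "fps_deriv a = a * g" "fps_deriv b = b * g" "fps_nth a 0 = fps_nth b 0"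
  shows "a = b"
proof -
  define d where "d = a - b"
  have d: "fps_deriv d = d * g" and d0: "fps_nth d 0 = 0"
    using assms by (simp_all add: d_def algebra_simps)
  have "fps_nth d n = 0" for n
  proof (induction n rule: less_induct)
    case (less n)
    show ?case
    proof (cases n)
      case (Suc p)
      have "of_nat (Suc p) * fps_nth d (Suc p) = fps_nth (d * g) p"
        using d by (metis Suc_eq_plus1 fps_deriv_nth)
      also have "\<dots> = 0"
        using less Suc by (auto simp: fps_mult_nth intro!: sum.neutral)
      finally show ?thesis using Suc by (simp del: of_nat_Suc)
    qed (use d0 in simp)
  qed
  then show ?thesis by (auto simp: d_def fps_eq_iff)
qed

text \<open>This is the product \<open>(1 + t) \<cdots> (m + t)\<close>; the recurrence of the cycle numbers
  supplies one factor at a time (\<open>stirling_fps_Suc\<close>).\<close>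

definition stirling_fps :: "nat \<Rightarrow> complex fps" where
  "stirling_fps m = Abs_fps (\<lambda>j. of_nat (stirling (Suc m) (Suc j)))"

text \<open>The expansion of \<open>\<Sum>i=1..m. 1 / (i + t)\<close> in powers of \<open>t\<close>.\<close>

definition harm_fps :: "nat \<Rightarrow> complex fps" where
  "harm_fps m = Abs_fps (\<lambda>n. (-1) ^ n * gen_harm (Suc n) m)"

lemma stirling_fps_Suc:
  "stirling_fps (Suc m) = stirling_fps m * (of_nat (Suc m) + fps_X)"
proof (rule fps_ext)
  fix j
  show "fps_nth (stirling_fps (Suc m)) j
      = fps_nth (stirling_fps m * (of_nat (Suc m) + fps_X)) j"
    unfolding stirling_fps_def distrib_left fps_of_nat[symmetric]
    by (cases j) (simp_all add: algebra_simps stirling.simps(4)[of "Suc m"])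
qed

lemma harm_fps_Suc:
  "(harm_fps (Suc m) - harm_fps m) * (of_nat (Suc m) + fps_X) = 1"
proof (rule fps_ext)
  fix n
  have nz: "(of_nat (Suc m) :: complex) \<noteq> 0" by (simp del: of_nat_Suc)
  show "fps_nth ((harm_fps (Suc m) - harm_fps m) * (of_nat (Suc m) + fps_X)) n = fps_nth 1 n"
    unfolding harm_fps_def distrib_left fps_of_nat[symmetric] gen_harm_def
    using nz by (cases n) (simp_all add: field_simps del: of_nat_Suc)
qed

text \<open>The logarithmic derivative of \<open>(1 + t) \<cdots> (m + t)\<close> is the sum of those of the factors;
  the product rule gives this without dividing or taking logarithms.\<close>

lemma fps_deriv_stirling_fps: "fps_deriv (stirling_fps m) = stirling_fps m * harm_fps m"
proof (induction m)
  case 0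
  have "stirling_fps 0 = 1"
    by (rule fps_ext) (simp add: stirling_fps_def)
  moreover have "harm_fps 0 = 0"
    by (rule fps_ext) (simp add: harm_fps_def gen_harm_def)
  ultimately show ?case by simp
next
  case (Suc m)
  let ?q = "of_nat (Suc m) + fps_X :: complex fps"
  have "fps_deriv (stirling_fps (Suc m)) = stirling_fps m + stirling_fps m * harm_fps m * ?q"
    unfolding stirling_fps_Suc by (simp add: Suc del: of_nat_Suc)
  also have "\<dots> = stirling_fps m * ((harm_fps (Suc m) - harm_fps m) * ?q)
                  + stirling_fps m * harm_fps m * ?q"
    by (simp only: harm_fps_Suc mult_1_right)
  also have "\<dots> = stirling_fps (Suc m) * harm_fps (Suc m)"
    unfolding stirling_fps_Suc by (simp add: algebra_simps del: of_nat_Suc)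
  finally show ?case .
qed

text \<open>The arguments of the Bell polynomial are such that the exponent \<open>G\<close> of its generating function
  is an antiderivative of \<open>harm_fps m\<close>. Hence \<open>exp G\<close> solves the same equation as
  \<open>stirling_fps m\<close>, and the factor \<open>m!\<close> adjusts the constant term.\<close>

lemma stirling_eq_complete_bell:
  "of_nat (stirling (Suc m) (Suc j))
     = fact m / fact j * complete_bell j (\<lambda>r. (-1) ^ (r - 1) * fact (r - 1) * gen_harm r m)"
proof -
  define G :: "complex fps" where
    "G = Abs_fps (\<lambda>r. if r = 0 then 0 else (-1) ^ (r - 1) * fact (r - 1) * gen_harm r m / fact r)"
  define F where "F = fps_exp 1 oo G"
  have G': "fps_deriv G = harm_fps m"
    by (rule fps_ext) (simp add: G_def harm_fps_def field_simps del: of_nat_Suc)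
  have F': "fps_deriv F = F * harm_fps m"
    unfolding F_def by (subst fps_compose_deriv) (simp_all add: G_def G'[symmetric])
  have "stirling_fps m = fps_const (fact m) * F"
  proof (rule fps_linear_ODE_unique[OF fps_deriv_stirling_fps])
    show "fps_deriv (fps_const (fact m) * F) = fps_const (fact m) * F * harm_fps m"
      by (simp add: F' mult.assoc)
    show "fps_nth (stirling_fps m) 0 = fps_nth (fps_const (fact m) * F) 0"
      by (simp add: stirling_fps_def F_def stirling_Suc_n_1 del: stirling.simps)
  qed
  then have "of_nat (stirling (Suc m) (Suc j)) = fact m * fps_nth F j"
    by (metis fps_mult_left_const_nth fps_nth_Abs_fps stirling_fps_def)
  then show ?thesis
    unfolding complete_bell_def G_def[symmetric] F_def[symmetric]
    by (simp del: stirling.simps)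
qed

section \<open>The two explicit formulas\<close>

theorem lemma1:
  fixes k m :: nat and x :: complex
  assumes "k \<le> m" and "Re x > 0"
  shows "gen_stirling_poly k m x =
           (\<Sum>j=0..k. (-1) powi (int j - int k) * x ^ j * of_nat ((j + m - k) choose (m - k))
              * of_nat (stirling (m + 1) (j + m - k + 1)))
       \<and> gen_stirling_poly k m x =
           (\<Sum>j=m-k..m. (-1) powi (int j - int m) * x ^ (j + k - m) * of_nat (j choose (m - k))
              * (fact m / fact j)
              * complete_bell j (\<lambda>r. (-1) ^ (r - 1) * fact (r - 1) * gen_harm r m))"
proof -
  have sgn: "(-1) powi (int a - int b) = ((-1) ^ (a + b) :: complex)" for a b
    by (cases "even b") (simp_all add: power_int_diff power_add)
  have first: "gen_stirling_poly k m x =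
      (\<Sum>j=0..k. (-1) powi (int j - int k) * x ^ j * of_nat ((j + m - k) choose (m - k))
         * of_nat (stirling (m + 1) (j + m - k + 1)))"
    unfolding gen_stirling_poly_taylor[OF \<open>k \<le> m\<close>] sgn
    by (rule sum.reindex_bij_witness[of _ "\<lambda>j. j + m - k" "\<lambda>n. n - (m - k)"])
       (use \<open>k \<le> m\<close> in \<open>auto simp: power_minus[of x] power_add mult_ac simp del: stirling.simps\<close>)
  have second: "gen_stirling_poly k m x =
      (\<Sum>j=m-k..m. (-1) powi (int j - int m) * x ^ (j + k - m) * of_nat (j choose (m - k))
         * (fact m / fact j)
         * complete_bell j (\<lambda>r. (-1) ^ (r - 1) * fact (r - 1) * gen_harm r m))"
    unfolding gen_stirling_poly_taylor[OF \<open>k \<le> m\<close>] sgn stirling_eq_complete_bell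
  proof (intro sum.cong refl, goal_cases)
    case (1 n)
    then obtain i where n: "n = m - k + i" by (metis atLeastAtMost_iff le_Suc_ex)
    obtain l where m: "m = k + l" using \<open>k \<le> m\<close> le_Suc_ex by blast
    \<comment> \<open>The signs agree because \<open>n + m = k + i + 2 * l\<close>.\<close>
    have "(-1) ^ (n + m) = ((-1) ^ k * (-1) ^ i :: complex)"
      by (simp add: n m power_add mult_ac flip: power_mult_distrib)
    then show ?case
      by (simp add: n m power_minus[of x i] mult_ac)
  qed
  from first second show ?thesis ..
qed

end
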